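(* Let $(X,d,\mu)$ be a metric measure space with $\mu$ doubling, let $r(\cdot)\in\mathcal{P}(X)$ with $1\le r^{-}\le r^{+}<+\infty$, and let $\varphi:X\to X$ be a non-singular Borel map. If $X$ is connected, then $L^{r(\cdot)}(X)$ does not admit compact composition operators $T_\varphi$; that is, the operator $T_\varphi:L^{r(\cdot)}(X)\to L^{r_\varphi(\cdot)}(X)$, $T_\varphi f=f\circ\varphi$, where $r_\varphi(\cdot)=r(\varphi(\cdot))$, is not compact.
   Context: $(X,d,\mu)$ is a metric space with a Borel regular measure $\mu$ such that every nonempty open set has positive measure and every bounded set has finite measure. $\mathcal{P}(X)$ is the set of Borel measurable functions $r:X\to[1,\infty)$; $r^{+}=\operatorname{ess\,sup}_X r$, $r^{-}=\operatorname{ess\,inf}_X r$. $L^{r(\cdot)}(X)$ is the set of measurable $f$ on $X$ such that $\rho(f/\eta)<\infty$ for some $\eta>0$, where $\rho(f)=\int_X|f(x)|^{r(x)}\,d\mu(x)$; it is a Banach space with norm $\|f\|_{r(\cdot)}=\inf\{\eta>0:\rho(f/\eta)\le1\}$. $\mu$ is doubling if there is $C>0$ with $\mu(B(x,2s))\le C\mu(B(x,s))$ for every ball $B(x,s)$. $\varphi$ is non-singular if $\mu(\varphi^{-1}(E))=0$ for every Borel $E$ with $\mu(E)=0$.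
   Formalization: The space X is additionally assumed to have at least two points; for a one-point space the claim is false, since L^{r(·)}(X) is then one-dimensional and T_φ is the identity, which is compact. *)

theory Defs
  imports "HOL-Analysis.Analysis" "HOL-Probability.Essential_Supremum"
begin

text \<open>
  The metric space is the whole type. The \<open>\<sigma>\<close>-algebra of \<open>M\<close> is only required to contain the Borel
  sets and to satisfy Borel regularity, so that both a measure on the Borel sets themselves and
  its completion (equivalently, a Borel regular outer measure restricted to its measurable sets)
  are covered.
\<close>

definition metric_measure_space :: "'a::metric_space measure \<Rightarrow> bool" where
  "metric_measure_space M \<longleftrightarrow>
     space M = UNIV \<and> sets borel \<subseteq> sets M \<and>
     (\<forall>A\<in>sets M. \<exists>B\<in>sets borel. A \<subseteq> B \<and> emeasure M B = emeasure M A) \<and>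
     (\<forall>U. open U \<and> U \<noteq> {} \<longrightarrow> 0 < emeasure M U) \<and>
     (\<forall>A\<in>sets M. bounded A \<longrightarrow> emeasure M A < \<infinity>)"

definition doubling :: "'a::metric_space measure \<Rightarrow> bool" where
  "doubling M \<longleftrightarrow>
     (\<exists>C::real. 0 < C \<and>
        (\<forall>x s. 0 < s \<longrightarrow> emeasure M (ball x (2 * s)) \<le> ennreal C * emeasure M (ball x s)))"

definition nonsingular :: "'a::metric_space measure \<Rightarrow> ('a \<Rightarrow> 'a) \<Rightarrow> bool" where
  "nonsingular M \<phi> \<longleftrightarrow>
     (\<forall>E\<in>sets borel. emeasure M E = 0 \<longrightarrow> emeasure M (\<phi> -` E) = 0)"

definition exponents :: "('a::metric_space \<Rightarrow> real) set" where
  "exponents = {r \<in> borel_measurable borel. \<forall>x. 1 \<le> r x}"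

definition exp_sup :: "'a measure \<Rightarrow> ('a \<Rightarrow> real) \<Rightarrow> ereal" where
  "exp_sup M r = esssup M (\<lambda>x. ereal (r x))"

definition exp_inf :: "'a measure \<Rightarrow> ('a \<Rightarrow> real) \<Rightarrow> ereal" where
  "exp_inf M r = Sup {z. AE x in M. z \<le> ereal (r x)}"


subsection \<open>The variable exponent Lebesgue space\<close>

definition modular :: "'a measure \<Rightarrow> ('a \<Rightarrow> real) \<Rightarrow> ('a \<Rightarrow> real) \<Rightarrow> ennreal" where
  "modular M r f = (\<integral>\<^sup>+ x. ennreal (\<bar>f x\<bar> powr r x) \<partial>M)"

definition Lvar_fun :: "'a measure \<Rightarrow> ('a \<Rightarrow> real) \<Rightarrow> ('a \<Rightarrow> real) set" where
  "Lvar_fun M r =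
     {f \<in> borel_measurable M. \<exists>\<eta>>0. modular M r (\<lambda>x. f x / \<eta>) < \<infinity>}"

definition Lvar_norm :: "'a measure \<Rightarrow> ('a \<Rightarrow> real) \<Rightarrow> ('a \<Rightarrow> real) \<Rightarrow> real" where
  "Lvar_norm M r f = Inf {\<eta>. 0 < \<eta> \<and> modular M r (\<lambda>x. f x / \<eta>) \<le> 1}"

definition Lvar_rel :: "'a measure \<Rightarrow> ('a \<Rightarrow> real) \<Rightarrow> (('a \<Rightarrow> real) \<times> ('a \<Rightarrow> real)) set" where
  "Lvar_rel M r = {(f, g). f \<in> Lvar_fun M r \<and> g \<in> Lvar_fun M r \<and> (AE x in M. f x = g x)}"

definition Lvar :: "'a measure \<Rightarrow> ('a \<Rightarrow> real) \<Rightarrow> ('a \<Rightarrow> real) set set" where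
  "Lvar M r = Lvar_fun M r // Lvar_rel M r"

text \<open>
  The distance of two classes is the norm of the difference of representatives. It does not depend
  on their choice: see \<open>Lvar_dist_class\<close> below. The value \<open>0\<close> outside the carrier is only there
  because \<open>Metric_space\<close> asks for symmetry and nonnegativity on the whole type.
\<close>

definition Lvar_dist ::
    "'a measure \<Rightarrow> ('a \<Rightarrow> real) \<Rightarrow> ('a \<Rightarrow> real) set \<Rightarrow> ('a \<Rightarrow> real) set \<Rightarrow> real" where
  "Lvar_dist M r F G =
     (if F \<in> Lvar M r \<and> G \<in> Lvar M r
      then Lvar_norm M r (\<lambda>x. (SOME f. f \<in> F) x - (SOME g. g \<in> G) x) else 0)"

text \<open>
  \<open>comp_op\<close> sends the class of \<open>f\<close> to the class of \<open>f \<circ> \<phi>\<close> in \<open>L\<^sup>r\<^sup>\<circ>\<^sup>\<phi>\<close>: see \<open>comp_op_class\<close> below.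
  If \<open>f \<circ> \<phi>\<close> lies outside \<open>L\<^sup>r\<^sup>\<circ>\<^sup>\<phi>\<close>, the result is \<open>{}\<close>, which is not an element of \<open>Lvar M (r \<circ> \<phi>)\<close>.
\<close>

definition comp_op ::
    "'a measure \<Rightarrow> ('a \<Rightarrow> real) \<Rightarrow> ('a \<Rightarrow> 'a) \<Rightarrow> ('a \<Rightarrow> real) set \<Rightarrow> ('a \<Rightarrow> real) set" where
  "comp_op M r \<phi> F = Lvar_rel M (r \<circ> \<phi>) `` ((\<lambda>f. f \<circ> \<phi>) ` F)"

text \<open>Linearity is not part of this definition; \<open>comp_op\<close> is linear by construction.\<close>

definition compact_map ::
    "'b set \<Rightarrow> ('b \<Rightarrow> 'b \<Rightarrow> real) \<Rightarrow> 'c set \<Rightarrow> ('c \<Rightarrow> 'c \<Rightarrow> real) \<Rightarrow> ('b \<Rightarrow> 'c) \<Rightarrow> bool" where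
  "compact_map V d W e T \<longleftrightarrow>
     T \<in> V \<rightarrow> W \<and>
     (\<forall>S. Metric_space.mbounded V d S \<longrightarrow>
        compactin (Metric_space.mtopology W e) (Metric_space.mtopology W e closure_of (T ` S)))"


subsection \<open>Well-definedness of the notions above\<close>

lemma powr_convex_nonneg:
  fixes a b p t :: real
  assumes "1 \<le> p" "0 \<le> a" "0 \<le> b" "0 \<le> t" "t \<le> 1"
  shows "((1 - t) * a + t * b) powr p \<le> (1 - t) * a powr p + t * b powr p"
proof -
  have scale: "(u * c) powr p \<le> u * c powr p" if "0 \<le> u" "u \<le> 1" "0 \<le> c" for u c :: real
  proof -
    have "u powr p \<le> u"
    proof (cases "u = 0")
      case False
      then show ?thesis using that assms(1) powr_mono'[of 1 p u] by simp
    qed auto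
    then show ?thesis using that by (simp add: powr_mult mult_right_mono)
  qed
  consider "a = 0" | "b = 0" | "a > 0" "b > 0" using assms by linarith
  then show ?thesis
  proof cases
    case 1 then show ?thesis using scale[of t b] assms by simp
  next
    case 2 then show ?thesis using scale[of "1 - t" a] assms by simp
  next
    case 3
    then show ?thesis using convex_onD[OF powr_convex[OF assms(1)], of t a b] assms by simp
  qed
qed

lemma modular_cong_AE: "(AE x in M. f x = g x) \<Longrightarrow> modular M r f = modular M r g"
  unfolding modular_def by (rule nn_integral_cong_AE) auto

lemma modular_scale:
  assumes [measurable]: "f \<in> borel_measurable M" "r \<in> borel_measurable M"
    and r: "\<And>x. 1 \<le> r x" and c: "0 \<le> c" "c \<le> 1"
  shows "modular M r (\<lambda>x. c * f x) \<le> ennreal c * modular M r f"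
proof -
  have "\<bar>c * f x\<bar> powr r x \<le> c * \<bar>f x\<bar> powr r x" for x
    using powr_convex_nonneg[OF r[of x], of 0 "\<bar>f x\<bar>" c] c by (simp add: abs_mult)
  then have "modular M r (\<lambda>x. c * f x) \<le> (\<integral>\<^sup>+ x. ennreal c * ennreal (\<bar>f x\<bar> powr r x) \<partial>M)"
    unfolding modular_def using c
    by (intro nn_integral_mono) (auto simp: ennreal_mult[symmetric] intro!: ennreal_leI)
  then show ?thesis
    unfolding modular_def by (simp add: nn_integral_cmult)
qed

lemma modular_add:
  assumes [measurable]: "f \<in> borel_measurable M" "g \<in> borel_measurable M" "r \<in> borel_measurable M"
    and r: "\<And>x. 1 \<le> r x" and pos: "0 < a" "0 < b"
    and le: "modular M r (\<lambda>x. f x / a) \<le> 1" "modular M r (\<lambda>x. g x / b) \<le> 1"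
  shows "modular M r (\<lambda>x. (f x + g x) / (a + b)) \<le> 1"
proof -
  define t where "t = b / (a + b)"
  have t: "0 \<le> t" "t \<le> 1" "1 - t = a / (a + b)"
    using pos by (auto simp: t_def field_simps)
  have "\<bar>(f x + g x) / (a + b)\<bar> powr r x
      \<le> (1 - t) * \<bar>f x / a\<bar> powr r x + t * \<bar>g x / b\<bar> powr r x" for x
  proof -
    have "(f x + g x) / (a + b) = (1 - t) * (f x / a) + t * (g x / b)"
      using pos unfolding t(3) by (simp add: t_def add_divide_distrib)
    then have "\<bar>(f x + g x) / (a + b)\<bar> \<le> \<bar>(1 - t) * (f x / a)\<bar> + \<bar>t * (g x / b)\<bar>"
      by (metis abs_triangle_ineq)
    also have "\<dots> = (1 - t) * \<bar>f x / a\<bar> + t * \<bar>g x / b\<bar>"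
      using t(1,2) by (simp only: abs_mult abs_of_nonneg diff_ge_0_iff_ge)
    finally have "\<bar>(f x + g x) / (a + b)\<bar> \<le> (1 - t) * \<bar>f x / a\<bar> + t * \<bar>g x / b\<bar>" .
    then have "\<bar>(f x + g x) / (a + b)\<bar> powr r x
        \<le> ((1 - t) * \<bar>f x / a\<bar> + t * \<bar>g x / b\<bar>) powr r x"
      using r[of x] by (intro powr_mono2) auto
    also have "\<dots> \<le> (1 - t) * \<bar>f x / a\<bar> powr r x + t * \<bar>g x / b\<bar> powr r x"
      using t by (intro powr_convex_nonneg r) auto
    finally show ?thesis .
  qed
  then have "modular M r (\<lambda>x. (f x + g x) / (a + b))
      \<le> (\<integral>\<^sup>+ x. ennreal (1 - t) * ennreal (\<bar>f x / a\<bar> powr r x)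
              + ennreal t * ennreal (\<bar>g x / b\<bar> powr r x) \<partial>M)"
    unfolding modular_def using t(1,2)
    by (intro nn_integral_mono)
       (auto simp: ennreal_mult[symmetric] ennreal_plus[symmetric] simp del: ennreal_plus
             intro!: ennreal_leI)
  also have "\<dots> = ennreal (1 - t) * modular M r (\<lambda>x. f x / a)
                + ennreal t * modular M r (\<lambda>x. g x / b)"
    unfolding modular_def by (simp add: nn_integral_add nn_integral_cmult)
  also have "\<dots> \<le> ennreal (1 - t) * 1 + ennreal t * 1"
    using le by (intro add_mono mult_left_mono) auto
  also have "\<dots> = 1"
    using t(1,2) by (simp add: ennreal_plus[symmetric] del: ennreal_plus)
  finally show ?thesis .
qed

lemma Lvar_norm_cong_AE: "(AE x in M. f x = g x) \<Longrightarrow> Lvar_norm M r f = Lvar_norm M r g"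
proof -
  assume "AE x in M. f x = g x"
  then have "modular M r (\<lambda>x. f x / \<eta>) = modular M r (\<lambda>x. g x / \<eta>)" for \<eta>
    by (intro modular_cong_AE) auto
  then show ?thesis by (simp add: Lvar_norm_def)
qed

lemma Lvar_norm_minus_commute: "Lvar_norm M r (\<lambda>x. f x - g x) = Lvar_norm M r (\<lambda>x. g x - f x)"
proof -
  have "modular M r (\<lambda>x. (f x - g x) / \<eta>) = modular M r (\<lambda>x. (g x - f x) / \<eta>)" for \<eta>
    unfolding modular_def
    by (intro nn_integral_cong) (simp only: abs_divide abs_minus_commute[of "f _"])
  then show ?thesis by (simp add: Lvar_norm_def)
qed

context
  fixes M :: "'a measure" and r :: "'a \<Rightarrow> real"
  assumes r_meas [measurable]: "r \<in> borel_measurable M" and r_ge: "\<And>x. 1 \<le> r x"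
begin

lemma Lvar_fun_iff:
  "f \<in> Lvar_fun M r \<longleftrightarrow>
     f \<in> borel_measurable M \<and> (\<exists>\<eta>>0. modular M r (\<lambda>x. f x / \<eta>) \<le> 1)"
proof
  assume f: "f \<in> Lvar_fun M r"
  then have [measurable]: "f \<in> borel_measurable M" by (simp add: Lvar_fun_def)
  from f obtain \<eta> where \<eta>: "\<eta> > 0" "modular M r (\<lambda>x. f x / \<eta>) < \<infinity>"
    by (auto simp: Lvar_fun_def)
  define m where "m = enn2real (modular M r (\<lambda>x. f x / \<eta>))"
  have m: "modular M r (\<lambda>x. f x / \<eta>) = ennreal m" "0 \<le> m"
    using \<eta> by (auto simp: m_def)
  define k where "k = max 1 m"
  have k: "1 \<le> k" "m \<le> k" by (auto simp: k_def)
  have "modular M r (\<lambda>x. f x / (\<eta> * k)) = modular M r (\<lambda>x. (1 / k) * (f x / \<eta>))"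
    by (simp add: mult.commute)
  also have "\<dots> \<le> ennreal (1 / k) * modular M r (\<lambda>x. f x / \<eta>)"
    using k by (intro modular_scale r_ge) auto
  also have "\<dots> = ennreal (m / k)"
    using k m by (simp add: ennreal_mult[symmetric])
  also have "\<dots> \<le> 1"
    using k by (simp add: ennreal_le_1)
  finally show "f \<in> borel_measurable M \<and> (\<exists>\<eta>>0. modular M r (\<lambda>x. f x / \<eta>) \<le> 1)"
    using \<eta> k by (intro conjI exI[of _ "\<eta> * k"]) auto
next
  assume "f \<in> borel_measurable M \<and> (\<exists>\<eta>>0. modular M r (\<lambda>x. f x / \<eta>) \<le> 1)"
  moreover have "x < \<infinity>" if "x \<le> 1" for x :: ennreal
    using that by (metis ennreal_one_less_top infinity_ennreal_def le_less_trans)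
  ultimately show "f \<in> Lvar_fun M r" by (auto simp: Lvar_fun_def)
qed

lemma Lvar_norm_nonneg: "f \<in> Lvar_fun M r \<Longrightarrow> 0 \<le> Lvar_norm M r f"
  unfolding Lvar_norm_def Lvar_fun_iff by (rule cInf_greatest) auto

lemma Lvar_norm_le: "0 < \<eta> \<Longrightarrow> modular M r (\<lambda>x. f x / \<eta>) \<le> 1 \<Longrightarrow> Lvar_norm M r f \<le> \<eta>"
  unfolding Lvar_norm_def by (rule cInf_lower) (auto intro: bdd_belowI[of _ 0])

lemma Lvar_norm_less:
  assumes "f \<in> Lvar_fun M r" "Lvar_norm M r f < c"
  obtains \<eta> where "0 < \<eta>" "\<eta> < c" "modular M r (\<lambda>x. f x / \<eta>) \<le> 1"
  using assms cInf_lessD[of "{\<eta>. 0 < \<eta> \<and> modular M r (\<lambda>x. f x / \<eta>) \<le> 1}" c]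
  unfolding Lvar_norm_def Lvar_fun_iff by auto

lemma Lvar_add:
  assumes f: "f \<in> Lvar_fun M r" and g: "g \<in> Lvar_fun M r"
  shows "(\<lambda>x. f x + g x) \<in> Lvar_fun M r"
    and "Lvar_norm M r (\<lambda>x. f x + g x) \<le> Lvar_norm M r f + Lvar_norm M r g"
proof -
  have [measurable]: "f \<in> borel_measurable M" "g \<in> borel_measurable M"
    using f g by (auto simp: Lvar_fun_iff)
  have main: "\<exists>\<eta>. 0 < \<eta> \<and> \<eta> < Lvar_norm M r f + Lvar_norm M r g + e \<and>
      modular M r (\<lambda>x. (f x + g x) / \<eta>) \<le> 1" if e: "e > 0" for e
  proof -
    obtain a where a: "0 < a" "a < Lvar_norm M r f + e / 2" "modular M r (\<lambda>x. f x / a) \<le> 1"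
      using Lvar_norm_less[OF f, of "Lvar_norm M r f + e / 2"] e by auto
    obtain b where b: "0 < b" "b < Lvar_norm M r g + e / 2" "modular M r (\<lambda>x. g x / b) \<le> 1"
      using Lvar_norm_less[OF g, of "Lvar_norm M r g + e / 2"] e by auto
    have "modular M r (\<lambda>x. (f x + g x) / (a + b)) \<le> 1"
      using a b by (intro modular_add r_ge) auto
    then show ?thesis using a b by (intro exI[of _ "a + b"]) auto
  qed
  show "(\<lambda>x. f x + g x) \<in> Lvar_fun M r"
    unfolding Lvar_fun_iff using main[of 1] by auto
  show "Lvar_norm M r (\<lambda>x. f x + g x) \<le> Lvar_norm M r f + Lvar_norm M r g"
  proof (rule field_le_epsilon)
    fix e :: real assume "e > 0"
    from main[OF this] obtain \<eta> where "0 < \<eta>" "\<eta> < Lvar_norm M r f + Lvar_norm M r g + e"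
      "modular M r (\<lambda>x. (f x + g x) / \<eta>) \<le> 1" by auto
    then show "Lvar_norm M r (\<lambda>x. f x + g x) \<le> Lvar_norm M r f + Lvar_norm M r g + e"
      using Lvar_norm_le[of \<eta> "\<lambda>x. f x + g x"] by linarith
  qed
qed

lemma Lvar_diff:
  assumes f: "f \<in> Lvar_fun M r" and g: "g \<in> Lvar_fun M r"
  shows "(\<lambda>x. f x - g x) \<in> Lvar_fun M r"
proof -
  have "(\<lambda>x. - g x) \<in> Lvar_fun M r"
    using g by (auto simp: Lvar_fun_def modular_def)
  from Lvar_add(1)[OF f this] show ?thesis by simp
qed

lemma Lvar_norm_eq_0_iff:
  assumes f: "f \<in> Lvar_fun M r"
  shows "Lvar_norm M r f = 0 \<longleftrightarrow> (AE x in M. f x = 0)"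
proof
  have [measurable]: "f \<in> borel_measurable M"
    using f by (auto simp: Lvar_fun_iff)
  assume "Lvar_norm M r f = 0"
  have small: "modular M r f \<le> ennreal e" if e: "0 < e" "e \<le> 1" for e
  proof -
    obtain \<eta> where \<eta>: "0 < \<eta>" "\<eta> < e" "modular M r (\<lambda>x. f x / \<eta>) \<le> 1"
      using Lvar_norm_less[OF f, of e] e \<open>Lvar_norm M r f = 0\<close> by auto
    have "modular M r f = modular M r (\<lambda>x. \<eta> * (f x / \<eta>))"
      using \<eta> by simp
    also have "\<dots> \<le> ennreal \<eta> * modular M r (\<lambda>x. f x / \<eta>)"
      using \<eta> e by (intro modular_scale r_ge) auto
    also have "\<dots> \<le> ennreal \<eta> * 1" using \<eta> by (intro mult_left_mono) auto
    also have "\<dots> \<le> ennreal e" using \<eta> by (simp add: ennreal_leI)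
    finally show ?thesis .
  qed
  have "modular M r f \<le> 0"
  proof (rule ennreal_le_epsilon)
    fix e :: real assume "e > 0"
    then show "modular M r f \<le> 0 + ennreal e"
      using small[of "min 1 e"] by (auto intro: order_trans ennreal_leI)
  qed
  then have "(\<integral>\<^sup>+ x. ennreal (\<bar>f x\<bar> powr r x) \<partial>M) = 0" by (simp add: modular_def)
  then have "AE x in M. ennreal (\<bar>f x\<bar> powr r x) = 0"
    by (subst (asm) nn_integral_0_iff_AE) auto
  then show "AE x in M. f x = 0" by eventually_elim auto
next
  assume ae: "AE x in M. f x = 0"
  have "Lvar_norm M r f = Lvar_norm M r (\<lambda>x. 0)"
    using ae by (rule Lvar_norm_cong_AE)
  also have "\<dots> = Inf {0<..}"
    by (simp add: Lvar_norm_def modular_def greaterThan_def)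
  finally show "Lvar_norm M r f = 0" by simp
qed

lemma equiv_Lvar_rel: "equiv (Lvar_fun M r) (Lvar_rel M r)"
proof (rule equivI)
  show "trans (Lvar_rel M r)"
  proof (rule transI)
    fix f g h assume *: "(f, g) \<in> Lvar_rel M r" "(g, h) \<in> Lvar_rel M r"
    then have "AE x in M. f x = g x" "AE x in M. g x = h x" by (auto simp: Lvar_rel_def)
    then have "AE x in M. f x = h x" by eventually_elim simp
    then show "(f, h) \<in> Lvar_rel M r" using * by (simp add: Lvar_rel_def)
  qed
  show "sym (Lvar_rel M r)"
    by (auto simp: Lvar_rel_def eq_commute intro: symI)
qed (auto simp: Lvar_rel_def refl_on_def)

lemma Lvar_some:
  assumes "F \<in> Lvar M r"
  shows "(SOME f. f \<in> F) \<in> F" "F \<subseteq> Lvar_fun M r"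
    "\<And>f g. f \<in> F \<Longrightarrow> g \<in> F \<Longrightarrow> AE x in M. f x = g x"
proof -
  have "F \<noteq> {}"
    using assms in_quotient_imp_non_empty[OF equiv_Lvar_rel] by (auto simp: Lvar_def)
  then show "(SOME f. f \<in> F) \<in> F" by (simp add: some_in_eq)
  show "F \<subseteq> Lvar_fun M r"
    using assms in_quotient_imp_subset[OF equiv_Lvar_rel] by (auto simp: Lvar_def)
  show "AE x in M. f x = g x" if "f \<in> F" "g \<in> F" for f g
    using assms that quotient_eq_iff[OF equiv_Lvar_rel, of F F f g]
    by (auto simp: Lvar_def Lvar_rel_def)
qed

lemma Lvar_dist_class:
  assumes F: "F \<in> Lvar M r" "f \<in> F" and G: "G \<in> Lvar M r" "g \<in> G"
  shows "Lvar_dist M r F G = Lvar_norm M r (\<lambda>x. f x - g x)"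
proof -
  have "AE x in M. (SOME f. f \<in> F) x = f x" "AE x in M. (SOME g. g \<in> G) x = g x"
    using Lvar_some[OF F(1)] F(2) Lvar_some[OF G(1)] G(2) by auto
  then have "AE x in M. (SOME f. f \<in> F) x - (SOME g. g \<in> G) x = f x - g x"
    by eventually_elim simp
  then show ?thesis
    using F G by (auto simp: Lvar_dist_def intro: Lvar_norm_cong_AE)
qed

lemma Metric_space_Lvar: "Metric_space (Lvar M r) (Lvar_dist M r)"
proof
  fix F G
  show "0 \<le> Lvar_dist M r F G"
    unfolding Lvar_dist_def
    by (auto intro!: Lvar_norm_nonneg Lvar_diff dest: Lvar_some(1,2))
  show "Lvar_dist M r F G = Lvar_dist M r G F"
    unfolding Lvar_dist_def using Lvar_norm_minus_commute by auto
next
  fix F G assume F: "F \<in> Lvar M r" and G: "G \<in> Lvar M r"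
  obtain f g where f: "f \<in> F" "f \<in> Lvar_fun M r" and g: "g \<in> G" "g \<in> Lvar_fun M r"
    using Lvar_some[OF F] Lvar_some[OF G] by blast
  have "Lvar_dist M r F G = 0 \<longleftrightarrow> (AE x in M. f x = g x)"
    using Lvar_dist_class[OF F f(1) G g(1)] Lvar_norm_eq_0_iff[OF Lvar_diff[OF f(2) g(2)]] by simp
  also have "\<dots> \<longleftrightarrow> (f, g) \<in> Lvar_rel M r"
    using f g by (simp add: Lvar_rel_def)
  also have "\<dots> \<longleftrightarrow> F = G"
    using quotient_eq_iff[OF equiv_Lvar_rel, of F G f g] F G f g by (auto simp: Lvar_def)
  finally show "Lvar_dist M r F G = 0 \<longleftrightarrow> F = G" .
next
  fix F G H assume F: "F \<in> Lvar M r" and G: "G \<in> Lvar M r" and H: "H \<in> Lvar M r"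
  obtain f g h where f: "f \<in> F" "f \<in> Lvar_fun M r" and g: "g \<in> G" "g \<in> Lvar_fun M r"
    and h: "h \<in> H" "h \<in> Lvar_fun M r"
    using Lvar_some[OF F] Lvar_some[OF G] Lvar_some[OF H] by blast
  show "Lvar_dist M r F H \<le> Lvar_dist M r F G + Lvar_dist M r G H"
    using Lvar_add(2)[OF Lvar_diff[OF f(2) g(2)] Lvar_diff[OF g(2) h(2)]]
      Lvar_dist_class[OF F f(1) G g(1)] Lvar_dist_class[OF G g(1) H h(1)]
      Lvar_dist_class[OF F f(1) H h(1)] by simp
qed

end

lemma comp_op_class:
  assumes M: "metric_measure_space M" and \<phi>: "\<phi> \<in> borel_measurable borel" "nonsingular M \<phi>"
    and f: "f \<in> Lvar_fun M r" "f \<circ> \<phi> \<in> Lvar_fun M (r \<circ> \<phi>)"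
  shows "comp_op M r \<phi> (Lvar_rel M r `` {f}) = Lvar_rel M (r \<circ> \<phi>) `` {f \<circ> \<phi>}"
proof -
  have rep: "AE x in M. (f \<circ> \<phi>) x = (g \<circ> \<phi>) x" if "(f, g) \<in> Lvar_rel M r" for g
  proof -
    have "AE x in M. f x = g x" using that by (simp add: Lvar_rel_def)
    then obtain N where N: "N \<in> sets M" "emeasure M N = 0" "{x \<in> space M. f x \<noteq> g x} \<subseteq> N"
      by (auto elim: AE_E)
    then obtain B where B: "B \<in> sets borel" "N \<subseteq> B" "emeasure M B = 0"
      using M unfolding metric_measure_space_def by metis
    have "\<phi> -` B \<in> sets M"
      using measurable_sets[OF \<phi>(1) B(1)] M by (auto simp: metric_measure_space_def)
    moreover have "emeasure M (\<phi> -` B) = 0"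
      using \<phi>(2) B by (auto simp: nonsingular_def)
    ultimately show ?thesis
      using N B M by (intro AE_I[of _ _ "\<phi> -` B"]) (auto simp: metric_measure_space_def)
  qed
  have ff: "(f, f) \<in> Lvar_rel M r" using f by (simp add: Lvar_rel_def)
  show ?thesis
  proof (intro equalityI subsetI)
    fix h assume "h \<in> comp_op M r \<phi> (Lvar_rel M r `` {f})"
    then obtain g where g: "(f, g) \<in> Lvar_rel M r" "(g \<circ> \<phi>, h) \<in> Lvar_rel M (r \<circ> \<phi>)"
      by (auto simp: comp_op_def)
    have "AE x in M. (g \<circ> \<phi>) x = h x" using g(2) by (simp add: Lvar_rel_def)
    with rep[OF g(1)] have "AE x in M. (f \<circ> \<phi>) x = h x" by eventually_elim simp
    then show "h \<in> Lvar_rel M (r \<circ> \<phi>) `` {f \<circ> \<phi>}"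
      using f(2) g(2) by (simp add: Lvar_rel_def)
  next
    fix h assume "h \<in> Lvar_rel M (r \<circ> \<phi>) `` {f \<circ> \<phi>}"
    then show "h \<in> comp_op M r \<phi> (Lvar_rel M r `` {f})"
      using ff by (auto simp: comp_op_def)
  qed
qed

end

theory Submission
  imports Defs
begin

text \<open>
  A composition operator between these spaces changes norms only through the image of the measure:
  the modular of \<open>f \<circ> \<phi>\<close> for the exponent \<open>r \<circ> \<phi>\<close> is the integral of \<open>\<bar>f\<bar>\<^sup>r\<close> against the measure
  \<open>A \<mapsto> \<mu>(\<phi>\<^sup>-\<^sup>1(A))\<close>. Non-singularity gives this measure a density \<open>h\<close> with respect to \<open>\<mu>\<close>. Its total
  mass is \<open>\<mu>(X) > 0\<close>, so \<open>h\<close> is at least some \<open>c > 0\<close> on a set \<open>E\<close> of positive measure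
  (\<open>ex_preimage_measure_ge\<close>). Functions that live on \<open>E\<close> are therefore not shrunk arbitrarily,
  and compactness fails as soon as \<open>E\<close> carries infinitely many disjoint sets of positive measure.

  Such sets exist because the space has no atoms. A connected space with two points has no isolated
  point, and under the doubling condition a point that is not isolated is a null set
  (\<open>emeasure_singleton_eq_0\<close>). The space is also separable, since disjoint balls have positive
  measure and bounded sets have finite measure (\<open>countable_separated\<close>); hence some point \<open>x\<close> has
  \<open>\<mu>(E \<inter> B(x,\<epsilon>)) > 0\<close> for every \<open>\<epsilon> > 0\<close> (\<open>ex_point_all_balls_positive\<close>). These measures decrease to
  \<open>\<mu>({x} \<inter> E) = 0\<close> without ever vanishing, so infinitely many of the annuli that \<open>E\<close> cuts out
  around \<open>x\<close> have positive measure (\<open>ex_infinite_disjoint_subsets\<close>).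

  On each of these sets \<open>A\<close> take the function \<open>\<mu>(A)\<^sup>-\<^sup>1\<^sup>/\<^sup>r\<close>, extended by zero. It has modular \<open>1\<close>, so
  these functions lie in the unit ball, while the images of any two of them are at distance at
  least \<open>c\<close> (\<open>Lvar_norm_bump_diff_ge\<close>). An infinite bounded set with a uniformly separated image
  contradicts compactness (\<open>compact_map_not_separated\<close>).
\<close>

section \<open>Measures on metric spaces\<close>

lemma metric_measure_spaceD:
  assumes "metric_measure_space M"
  shows "space M = UNIV"
    and "A \<in> sets borel \<Longrightarrow> A \<in> sets M"
    and "open U \<Longrightarrow> U \<noteq> {} \<Longrightarrow> 0 < emeasure M U"
    and "A \<in> sets borel \<Longrightarrow> bounded A \<Longrightarrow> emeasure M A < \<infinity>"
  using assms by (auto simp: metric_measure_space_def)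

text \<open>
  Non-singularity speaks of Borel null sets only, while the exceptional set of an almost everywhere
  statement lies in the possibly larger \<open>\<sigma>\<close>-algebra of \<open>M\<close>. Borel regularity encloses it in a
  Borel null set.
\<close>

lemma AE_comp_nonsingular:
  assumes M: "metric_measure_space M" and \<phi>: "\<phi> \<in> borel_measurable borel" "nonsingular M \<phi>"
    and P: "AE x in M. P x"
  shows "AE x in M. P (\<phi> x)"
proof -
  obtain N where N: "N \<in> sets M" "emeasure M N = 0" "{x \<in> space M. \<not> P x} \<subseteq> N"
    using P by (auto elim: AE_E)
  then obtain B where B: "B \<in> sets borel" "N \<subseteq> B" "emeasure M B = 0"
    using M unfolding metric_measure_space_def by metis
  have "\<phi> -` B \<in> null_sets M"
    using measurable_sets[OF \<phi>(1) B(1)] metric_measure_spaceD[OF M] \<phi>(2) B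
    by (auto simp: nonsingular_def)
  then show ?thesis
    by (rule AE_I') (use N B metric_measure_spaceD(1)[OF M] in auto)
qed

text \<open>
  Choose \<open>y \<noteq> x\<close> near \<open>x\<close> and put \<open>s = d(x,y)\<close>. The ball \<open>B(y,s)\<close> misses \<open>x\<close>, but its double contains
  it. By doubling, \<open>\<mu>({x})\<close> is at most \<open>C\<close> times the measure of a punctured ball around \<open>x\<close>. The
  punctured balls shrink to the empty set, so their measures tend to zero.
\<close>

lemma emeasure_singleton_eq_0:
  fixes M :: "'a::metric_space measure"
  assumes M: "metric_measure_space M" and dbl: "doubling M" and x: "x islimpt UNIV"
  shows "emeasure M {x} = 0"
proof -
  obtain C :: real where C: "\<And>y s. 0 < s \<Longrightarrow>
      emeasure M (ball y (2 * s)) \<le> ennreal C * emeasure M (ball y s)"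
    using dbl unfolding doubling_def by blast
  define A where "A k = ball x (2 / real (Suc k)) - {x}" for k
  have A: "A k \<in> sets M" "emeasure M (A k) \<noteq> \<infinity>" for k
    using metric_measure_spaceD(2,4)[OF M, of "A k"]
    by (auto simp: A_def bounded_diff less_top)
  have le: "emeasure M {x} \<le> ennreal C * emeasure M (A k)" for k
  proof -
    obtain y where y: "y \<noteq> x" "dist y x < 1 / real (Suc k)"
      using x unfolding islimpt_approachable
      by (metis of_nat_0_less_iff zero_less_Suc zero_less_divide_1_iff)
    have "emeasure M {x} \<le> emeasure M (ball y (2 * dist y x))"
      using y metric_measure_spaceD(2)[OF M] by (intro emeasure_mono) auto
    also have "\<dots> \<le> ennreal C * emeasure M (ball y (dist y x))"
      using y by (intro C) auto
    also have "\<dots> \<le> ennreal C * emeasure M (A k)"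
    proof (intro mult_left_mono emeasure_mono)
      show "ball y (dist y x) \<subseteq> A k"
      proof
        fix z assume z: "z \<in> ball y (dist y x)"
        have "dist x z \<le> dist y x + dist y z" by (metis dist_commute dist_triangle)
        also have "\<dots> < 2 / real (Suc k)" using y z by auto
        finally show "z \<in> A k" using z by (auto simp: A_def)
      qed
    qed (use A in auto)
    finally show ?thesis .
  qed
  have empty: "(\<Inter>k. A k) = {}"
  proof (rule ccontr)
    assume "(\<Inter>k. A k) \<noteq> {}"
    then obtain z where z: "\<And>k. z \<in> A k" by auto
    then have "0 < dist x z" using z[of 0] by (auto simp: A_def)
    then obtain k where "inverse (real (Suc k)) < dist x z / 2"
      using reals_Archimedean[of "dist x z / 2"] by auto
    moreover have "dist x z < 2 / real (Suc k)" using z[of k] by (auto simp: A_def)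
    ultimately show False by (simp add: field_simps)
  qed
  have "decseq A"
    unfolding A_def decseq_def
    by (auto intro!: divide_left_mono elim!: less_le_trans)
  then have "(\<lambda>k. emeasure M (A k)) \<longlonglongrightarrow> emeasure M (\<Inter>k. A k)"
    using A by (intro Lim_emeasure_decseq) auto
  then have "(\<lambda>k. ennreal C * emeasure M (A k)) \<longlonglongrightarrow> ennreal C * 0"
    unfolding empty by (intro ennreal_tendsto_cmult) auto
  then have "emeasure M {x} \<le> ennreal C * 0"
    using le by (intro LIMSEQ_le_const[of _ "ennreal C * 0"]) auto
  then show ?thesis by simp
qed

text \<open>
  The balls of radius \<open>e/2\<close> around the points of an \<open>e\<close>-separated set are disjoint and have positive
  measure. Those with centre in a fixed bounded set have a finite sum of measures, and a summable
  family has only countably many nonzero terms.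
\<close>

lemma countable_separated:
  fixes M :: "'a::metric_space measure" and S :: "'a set"
  assumes M: "metric_measure_space M" and e: "0 < e"
    and sep: "\<And>s t. s \<in> S \<Longrightarrow> t \<in> S \<Longrightarrow> s \<noteq> t \<Longrightarrow> e \<le> dist s t"
  shows "countable S"
proof -
  \<comment> \<open>an arbitrary centre for the exhaustion of the space by balls of integer radius\<close>
  fix a :: 'a
  define b where "b s = ball s (e / 2)" for s :: 'a
  have b: "b s \<in> sets M" "emeasure M (b s) \<noteq> \<infinity>" "0 < measure M (b s)" for s
    using metric_measure_spaceD(2-4)[OF M, of "b s"] e
    by (auto simp: b_def less_top measure_def enn2real_positive_iff)
  have "countable (S \<inter> ball a (real n))" for n
  proof -
    let ?S = "S \<inter> ball a (real n)" and ?B = "ball a (real n + e)"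
    have B: "?B \<in> sets M" "emeasure M ?B < \<infinity>"
      using metric_measure_spaceD(2,4)[OF M, of ?B] by auto
    have "sum (\<lambda>s. measure M (b s)) F \<le> measure M ?B" if F: "F \<subseteq> ?S" "finite F" for F
    proof -
      have "disjoint_family_on b F"
      proof (unfold disjoint_family_on_def, intro ballI impI)
        fix s t assume st: "s \<in> F" "t \<in> F" "s \<noteq> t"
        then have "e \<le> dist s t" using sep F by auto
        then show "b s \<inter> b t = {}"
          by (auto simp: b_def) (smt (verit) dist_commute dist_triangle field_sum_of_halves)
      qed
      then have "sum (\<lambda>s. measure M (b s)) F = measure M (\<Union>s\<in>F. b s)"
        using F b by (intro measure_finite_Union[symmetric]) auto
      also have "\<dots> \<le> measure M ?B"
      proof (rule measure_mono_fmeasurable)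
        show "(\<Union>s\<in>F. b s) \<subseteq> ?B"
        proof clarify
          fix s z assume "s \<in> F" "z \<in> b s"
          then have "dist a s < real n" "dist s z < e" using F e by (auto simp: b_def)
          then show "z \<in> ?B" using dist_triangle[of a z s] by auto
        qed
        show "(\<Union>s\<in>F. b s) \<in> sets M" using b F by (intro sets.finite_UN) auto
        show "?B \<in> fmeasurable M" using B by (auto intro: fmeasurableI)
      qed
      finally show ?thesis .
    qed
    then have "(\<lambda>s. measure M (b s)) summable_on ?S"
      by (intro nonneg_bdd_above_summable_on) (auto intro!: bdd_aboveI2)
    then have "countable {s \<in> ?S. measure M (b s) \<noteq> 0}"
      by (rule summable_countable_real)
    moreover have "{s \<in> ?S. measure M (b s) \<noteq> 0} = ?S"
      using b(3)[THEN less_imp_neq] by auto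
    ultimately show ?thesis by simp
  qed
  then have "countable (\<Union>n. S \<inter> ball a (real n))" by (intro countable_UN) auto
  moreover have "S \<subseteq> (\<Union>n. S \<inter> ball a (real n))"
    using reals_Archimedean2 by auto
  ultimately show ?thesis by (rule countable_subset[rotated])
qed

text \<open>
  A maximal \<open>e\<close>-separated set is an \<open>e\<close>-net. Nets at all scales make the space separable.
\<close>

lemma countable_net:
  fixes M :: "'a::metric_space measure"
  assumes M: "metric_measure_space M" and e: "0 < e"
  obtains S :: "'a set" where "countable S" "\<And>x. \<exists>s\<in>S. dist s x < e"
proof -
  define Sep where "Sep = {S :: 'a set. \<forall>s\<in>S. \<forall>t\<in>S. s \<noteq> t \<longrightarrow> e \<le> dist s t}"
  have "\<exists>S\<in>Sep. \<forall>X\<in>Sep. S \<subseteq> X \<longrightarrow> X = S"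
  proof (rule subset_Zorn')
    fix \<C> assume C: "subset.chain Sep \<C>"
    show "\<Union>\<C> \<in> Sep"
      unfolding Sep_def
    proof (intro CollectI ballI impI)
      fix s t assume "s \<in> \<Union>\<C>" "t \<in> \<Union>\<C>" and ne: "s \<noteq> t"
      then obtain X Y where XY: "X \<in> \<C>" "Y \<in> \<C>" "s \<in> X" "t \<in> Y" by auto
      then have "X \<subseteq> Y \<or> Y \<subseteq> X" using C by (auto simp: subset_chain_def)
      then obtain Z where "Z \<in> \<C>" "s \<in> Z" "t \<in> Z" using XY by blast
      then show "e \<le> dist s t" using C ne by (auto simp: subset_chain_def Sep_def)
    qed
  qed
  then obtain S where S: "S \<in> Sep" and max: "\<And>X. X \<in> Sep \<Longrightarrow> S \<subseteq> X \<Longrightarrow> X = S" by blast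
  have "\<exists>s\<in>S. dist s x < e" for x
  proof (rule ccontr)
    assume far: "\<not> (\<exists>s\<in>S. dist s x < e)"
    then have "insert x S \<in> Sep"
      using S by (auto simp: Sep_def not_less dist_commute)
    then have "x \<in> S" using max by blast
    then show False using far e by auto
  qed
  moreover have "countable S"
    using countable_separated[OF M e, of S] S by (auto simp: Sep_def)
  ultimately show ?thesis using that by blast
qed

text \<open>
  Otherwise every point has a ball in which \<open>E\<close> is null. Each such ball contains a smaller one from a
  fixed countable family, so \<open>E\<close> is covered by countably many null sets.
\<close>

lemma ex_point_all_balls_positive:
  fixes M :: "'a::metric_space measure"
  assumes M: "metric_measure_space M" and E: "E \<in> sets borel" "emeasure M E \<noteq> 0"
  obtains x where "\<And>e. 0 < e \<Longrightarrow> emeasure M (E \<inter> ball x e) \<noteq> 0"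
proof (rule ccontr)
  assume "\<not> thesis"
  then have null: "\<exists>e>0. emeasure M (E \<inter> ball x e) = 0" for x using that by blast
  have "\<forall>n. \<exists>S :: 'a set. countable S \<and> (\<forall>x. \<exists>s\<in>S. dist s x < 1 / real (Suc n))"
  proof
    fix n
    show "\<exists>S :: 'a set. countable S \<and> (\<forall>x. \<exists>s\<in>S. dist s x < 1 / real (Suc n))"
      by (rule countable_net[OF M, of "1 / real (Suc n)"]) auto
  qed
  from choice[OF this] obtain S :: "nat \<Rightarrow> 'a set" where
      "\<forall>n. countable (S n) \<and> (\<forall>x. \<exists>s\<in>S n. dist s x < 1 / real (Suc n))" ..
  then have S: "countable (S n)" "\<exists>s\<in>S n. dist s x < 1 / real (Suc n)" for n x
    by simp_all
  define Z where "Z n = {s \<in> S n. emeasure M (E \<inter> ball s (1 / real (Suc n))) = 0}" for n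
  have Z: "countable (Z n)" for n
    by (rule countable_subset[OF _ S(1)]) (auto simp: Z_def)
  have "E \<inter> ball s (1 / real (Suc n)) \<in> null_sets M" if "s \<in> Z n" for s n
  proof (rule null_setsI)
    show "emeasure M (E \<inter> ball s (1 / real (Suc n))) = 0"
      using that unfolding Z_def by blast
    show "E \<inter> ball s (1 / real (Suc n)) \<in> sets M"
      by (rule metric_measure_spaceD(2)[OF M]) (use E(1) in simp)
  qed
  then have "(\<Union>s\<in>Z n. E \<inter> ball s (1 / real (Suc n))) \<in> null_sets M" for n
    by (rule null_sets_UN'[OF Z])
  then have "(\<Union>n. \<Union>s\<in>Z n. E \<inter> ball s (1 / real (Suc n))) \<in> null_sets M"
    by (rule null_sets_UN)
  moreover have "E \<subseteq> (\<Union>n. \<Union>s\<in>Z n. E \<inter> ball s (1 / real (Suc n)))"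
  proof
    fix x assume x: "x \<in> E"
    obtain e where e: "e > 0" "emeasure M (E \<inter> ball x e) = 0" using null by blast
    obtain n where n: "inverse (real (Suc n)) < e / 2" using reals_Archimedean[of "e / 2"] e by auto
    obtain s where s: "s \<in> S n" "dist s x < 1 / real (Suc n)" using S(2) by blast
    have "ball s (1 / real (Suc n)) \<subseteq> ball x e"
    proof
      fix z assume "z \<in> ball s (1 / real (Suc n))"
      then have "dist s x + dist s z < e" using s n by (auto simp: inverse_eq_divide)
      then show "z \<in> ball x e"
        using dist_triangle[of x z s] by (simp add: dist_commute)
    qed
    then have "E \<inter> ball s (1 / real (Suc n)) \<subseteq> E \<inter> ball x e" by blast
    moreover have "E \<inter> ball x e \<in> sets M"
      by (rule metric_measure_spaceD(2)[OF M]) (use E(1) in simp)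
    ultimately have "emeasure M (E \<inter> ball s (1 / real (Suc n))) \<le> emeasure M (E \<inter> ball x e)"
      by (rule emeasure_mono)
    then have "s \<in> Z n" using e(2) s(1) by (simp add: Z_def)
    moreover have "x \<in> E \<inter> ball s (1 / real (Suc n))" using s(2) x by simp
    ultimately show "x \<in> (\<Union>n. \<Union>s\<in>Z n. E \<inter> ball s (1 / real (Suc n)))" by blast
  qed
  ultimately have "E \<in> null_sets M"
    using null_sets_subset E metric_measure_spaceD(2)[OF M] by blast
  then show False using E by auto
qed

text \<open>
  The sets are the annuli of \<open>E\<close> around the point \<open>x\<close> of the previous lemma. If almost all of them were
  null, then \<open>\<mu>(E \<inter> B(x, 1/k))\<close> would be eventually constant and positive, although it tends to
  the measure of a subset of \<open>{x}\<close>. Null annuli remain in the sequence \<open>A\<close>, and \<open>K\<close> selects the others.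
\<close>

lemma ex_infinite_disjoint_subsets:
  fixes M :: "'a::metric_space measure"
  assumes M: "metric_measure_space M" and pt: "\<And>x. emeasure M {x} = 0"
    and E: "E \<in> sets borel" "emeasure M E \<noteq> 0"
  obtains A :: "nat \<Rightarrow> 'a set" and K where "infinite K" "disjoint_family A"
    "\<And>k. A k \<in> sets borel" "\<And>k. A k \<subseteq> E" "\<And>k. k \<in> K \<Longrightarrow> emeasure M (A k) \<noteq> 0"
    "\<And>k. emeasure M (A k) < \<infinity>"
proof -
  obtain x where x: "\<And>e. 0 < e \<Longrightarrow> emeasure M (E \<inter> ball x e) \<noteq> 0"
    using ex_point_all_balls_positive[OF M E] by blast
  define F where "F k = E \<inter> ball x (1 / real (Suc k))" for k
  define A where "A k = F k - F (Suc k)" for k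
  define K where "K = {k. emeasure M (A k) \<noteq> 0}"
  have F: "F k \<in> sets borel" "F k \<in> sets M" "emeasure M (F k) < \<infinity>" "emeasure M (F k) \<noteq> 0" for k
    using E x metric_measure_spaceD(2,4)[OF M, of "F k"] by (auto simp: F_def bounded_Int)
  have A: "A k \<in> sets borel" "emeasure M (A k) < \<infinity>" for k
    using F metric_measure_spaceD(2)[OF M] by (auto simp: A_def intro: le_less_trans[OF emeasure_mono])
  have dec: "decseq F"
    unfolding F_def decseq_def by (auto intro!: divide_left_mono elim!: less_le_trans)
  have disj: "A k \<inter> A l = {}" if "k < l" for k l
    using decseqD[OF dec, of "Suc k" l] that by (auto simp: A_def)
  have "infinite K"
  proof
    assume "finite K"
    then obtain N where N: "\<And>k. k \<in> K \<Longrightarrow> k < N" using finite_nat_set_iff_bounded by auto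
    have const: "emeasure M (F (N + k)) = emeasure M (F N)" for k
    proof (induction k)
      case (Suc k)
      have "emeasure M (A (N + k)) = 0" using N[of "N + k"] by (auto simp: K_def)
      moreover have "emeasure M (F (N + k)) \<le> emeasure M (F (Suc (N + k))) + emeasure M (A (N + k))"
        using F A metric_measure_spaceD(2)[OF M]
        by (intro order_trans[OF emeasure_mono emeasure_subadditive]) (auto simp: A_def)
      moreover have "emeasure M (F (Suc (N + k))) \<le> emeasure M (F (N + k))"
        using decseqD[OF dec, of "N + k" "Suc (N + k)"] F by (intro emeasure_mono) auto
      ultimately show ?case using Suc by auto
    qed simp
    have "(\<Inter>k. F k) \<subseteq> {x}"
    proof
      fix z assume z: "z \<in> (\<Inter>k. F k)"
      show "z \<in> {x}"
      proof (rule ccontr)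
        assume "z \<notin> {x}"
        then obtain k where "inverse (real (Suc k)) < dist x z"
          using reals_Archimedean[of "dist x z"] by auto
        then show False using z by (auto simp: F_def inverse_eq_divide dest!: spec[of _ k])
      qed
    qed
    then have "emeasure M (\<Inter>k. F k) \<le> emeasure M {x}"
      using metric_measure_spaceD(2)[OF M] by (intro emeasure_mono) auto
    then have "(\<lambda>k. emeasure M (F k)) \<longlonglongrightarrow> 0"
      using Lim_emeasure_decseq[of F M] F dec pt by (auto simp: less_top)
    then have "(\<lambda>k. emeasure M (F (k + N))) \<longlonglongrightarrow> 0" by (rule LIMSEQ_ignore_initial_segment)
    then have "(\<lambda>k::nat. emeasure M (F N)) \<longlonglongrightarrow> 0" using const by (simp add: add.commute)
    then show False using F(4)[of N] LIMSEQ_const_iff by blast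
  qed
  moreover have "disjoint_family A"
    unfolding disjoint_family_on_def using disj by (metis Int_commute linorder_neqE_nat)
  ultimately show ?thesis
    using A by (intro that[of K A]) (auto simp: K_def A_def F_def)
qed

text \<open>
  \<open>E\<close> is a set where the Radon-Nikodym density of the image measure is at least \<open>c\<close>. One can find
  it with positive measure because the image measure has the same nonzero total mass as \<open>M\<close>.
\<close>

lemma ex_preimage_measure_ge:
  fixes M :: "'a::metric_space measure"
  assumes M: "metric_measure_space M" and \<phi>: "\<phi> \<in> borel_measurable borel" "nonsingular M \<phi>"
  obtains c :: real and E where "0 < c" "c \<le> 1" "E \<in> sets borel" "emeasure M E \<noteq> 0"
    "\<And>A. A \<in> sets borel \<Longrightarrow> A \<subseteq> E \<Longrightarrow> ennreal c * emeasure M A \<le> emeasure M (\<phi> -` A)"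
proof -
  have bor: "sets borel \<subseteq> sets M" and sp: "space M = UNIV"
    using metric_measure_spaceD[OF M] by auto
  \<comment> \<open>The Radon-Nikodym theorem needs both measures on one \<open>\<sigma>\<close>-algebra, so \<open>M\<close> is restricted to the
      Borel sets, where \<open>\<phi>\<close> is known to be measurable and nonsingular.\<close>
  define M0 where "M0 = distr M borel (\<lambda>x. x)"
  define N where "N = distr M borel \<phi>"
  have id: "(\<lambda>x. x) \<in> measurable M borel" and phi: "\<phi> \<in> measurable M borel"
    using bor sp \<phi>(1) by (auto simp: measurable_def)
  have M0: "emeasure M0 A = emeasure M A" and N: "emeasure N A = emeasure M (\<phi> -` A)"
    if "A \<in> sets borel" for A
    using that id phi sp by (auto simp: M0_def N_def emeasure_distr)
  have [measurable_cong, simp]: "sets M0 = sets borel" "sets N = sets borel" "space M0 = UNIV"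
    by (auto simp: M0_def N_def)
  fix a :: 'a
  interpret M0: sigma_finite_measure M0
  proof
    have "(\<Union>n. ball a (real n)) = UNIV" using reals_Archimedean2 by auto
    then show "\<exists>A::'a set set. countable A \<and> A \<subseteq> sets M0 \<and> \<Union> A = space M0 \<and> (\<forall>a\<in>A. emeasure M0 a \<noteq> \<infinity>)"
      using metric_measure_spaceD(4)[OF M]
      by (intro exI[of _ "range (\<lambda>n. ball a (real n))"]) (auto simp: M0 less_top)
  qed
  have "absolutely_continuous M0 N"
    unfolding absolutely_continuous_def
    using \<phi>(2) by (auto simp: null_sets_def M0 N nonsingular_def)
  then obtain h where [measurable]: "h \<in> borel_measurable M0" and h: "density M0 h = N"
    using M0.Radon_Nikodym[of N] by auto
  define E where "E n = {x. ennreal (1 / real (Suc n)) \<le> h x}" for n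
  have E: "E n \<in> sets borel" for n
  proof -
    have "{x \<in> space M0. ennreal (1 / real (Suc n)) \<le> h x} \<in> sets M0" by measurable
    then show ?thesis by (simp add: E_def)
  qed
  have "\<exists>n. emeasure M (E n) \<noteq> 0"
  proof (rule ccontr)
    assume "\<not> ?thesis"
    then have "\<And>n. E n \<in> null_sets M0" using E M0 by (auto simp: null_sets_def)
    then have "(\<Union>n. E n) \<in> null_sets M0" by (intro null_sets_UN)
    then have "AE x in M0. h x = 0"
    proof (rule AE_I')
      show "{x \<in> space M0. h x \<noteq> 0} \<subseteq> (\<Union>n. E n)"
      proof
        fix x assume x: "x \<in> {x \<in> space M0. h x \<noteq> 0}"
        have "\<exists>n. ennreal (1 / real (Suc n)) \<le> h x"
        proof (cases "h x" rule: ennreal_cases)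
          case (real u)
          then have "0 < u" using x by (cases "u = 0") auto
          then obtain n where "inverse (real (Suc n)) < u" using reals_Archimedean by blast
          then have "ennreal (1 / real (Suc n)) \<le> ennreal u"
            by (intro ennreal_leI) (simp add: inverse_eq_divide)
          then show ?thesis using real by auto
        qed auto
        then show "x \<in> (\<Union>n. E n)" by (auto simp: E_def)
      qed
    qed
    then have "emeasure (density M0 h) UNIV = 0"
      by (subst emeasure_density) (auto simp: nn_integral_0_iff_AE)
    then have "emeasure M UNIV = 0" using N[of UNIV] by (simp add: h)
    then show False using metric_measure_spaceD(3)[OF M, of UNIV] by auto
  qed
  then obtain n where n: "emeasure M (E n) \<noteq> 0" by blast
  have "ennreal (1 / real (Suc n)) * emeasure M A \<le> emeasure M (\<phi> -` A)"
    if A: "A \<in> sets borel" "A \<subseteq> E n" for A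
  proof -
    have "ennreal (1 / real (Suc n)) * emeasure M A
        = (\<integral>\<^sup>+ x. ennreal (1 / real (Suc n)) * indicator A x \<partial>M0)"
      using A M0 by (simp add: nn_integral_cmult_indicator)
    also have "\<dots> \<le> (\<integral>\<^sup>+ x. h x * indicator A x \<partial>M0)"
      using A(2) by (intro nn_integral_mono) (auto simp: E_def split: split_indicator)
    also have "\<dots> = emeasure N A"
      using A by (simp add: h[symmetric] emeasure_density)
    finally show ?thesis using N A by simp
  qed
  then show ?thesis
    using n E by (intro that[of "1 / real (Suc n)" "E n"]) auto
qed

section \<open>Compact maps and separated sets\<close>

text \<open>
  The image of \<open>S\<close> is totally bounded, so finitely many balls of radius \<open>\<delta>/2\<close> cover it. Two distinct
  points of the infinite set \<open>S\<close> then have images in the same ball, closer than \<open>\<delta>\<close>.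
\<close>

lemma compact_map_not_separated:
  assumes "Metric_space V d" "Metric_space W e" and T: "compact_map V d W e T"
    and S: "Metric_space.mbounded V d S" "infinite S"
    and \<delta>: "0 < \<delta>" and sep: "\<And>x y. x \<in> S \<Longrightarrow> y \<in> S \<Longrightarrow> x \<noteq> y \<Longrightarrow> \<delta> \<le> e (T x) (T y)"
  shows False
proof -
  interpret V: Metric_space V d by fact
  interpret W: Metric_space W e by fact
  have SV: "S \<subseteq> V" using S(1) by (rule V.mbounded_subset_mspace)
  then have "T ` S \<subseteq> W" using T by (auto simp: compact_map_def)
  moreover have "compactin W.mtopology (W.mtopology closure_of (T ` S))"
    using T S(1) by (auto simp: compact_map_def)
  ultimately have "W.mtotally_bounded (T ` S)"
    by (intro W.compact_closure_of_imp_mtotally_bounded)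
  then obtain K where K: "finite K" "T ` S \<subseteq> (\<Union>y\<in>K. W.mball y (\<delta> / 2))"
    using \<delta> unfolding W.mtotally_bounded_def by (meson half_gt_zero)
  then have "\<forall>x\<in>S. \<exists>y\<in>K. T x \<in> W.mball y (\<delta> / 2)" by blast
  then obtain p where p: "\<And>x. x \<in> S \<Longrightarrow> p x \<in> K \<and> T x \<in> W.mball (p x) (\<delta> / 2)" by metis
  have "\<not> inj_on p S"
    using S(2) K(1) p by (metis finite_imageD finite_subset image_subsetI)
  then obtain x y where xy: "x \<in> S" "y \<in> S" "x \<noteq> y" "p x = p y" by (auto simp: inj_on_def)
  have "e (T x) (T y) \<le> e (p x) (T x) + e (p x) (T y)"
    using p[OF xy(1)] p[OF xy(2)] xy(4) W.triangle[of "T x" "p x" "T y"] W.commute by auto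
  also have "\<dots> < \<delta>" using p[OF xy(1)] p[OF xy(2)] xy(4) by auto
  finally show False using sep xy by force
qed

section \<open>Bumps of unit modular\<close>

text \<open>
  The height varies with the exponent so that \<open>\<bar>bump\<bar>\<^sup>r\<close> is the constant \<open>1/\<mu>(A)\<close> on \<open>A\<close>; the modular
  is then \<open>1\<close> exactly, whatever \<open>r\<close> is.
\<close>

definition bump :: "'a measure \<Rightarrow> ('a \<Rightarrow> real) \<Rightarrow> 'a set \<Rightarrow> 'a \<Rightarrow> real" where
  "bump M r A x = indicator A x * measure M A powr (- 1 / r x)"

lemma emeasure_eq_ennreal_of_measure_pos:
  "0 < measure M A \<Longrightarrow> emeasure M A = ennreal (measure M A)"
  by (metis emeasure_eq_ennreal_measure enn2real_top measure_def less_irrefl)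

lemma bump_powr:
  assumes "1 \<le> r x" "0 < measure M A"
  shows "\<bar>bump M r A x\<bar> powr r x = indicator A x / measure M A"
proof (cases "x \<in> A")
  case True
  have "\<bar>bump M r A x\<bar> powr r x = measure M A powr (- 1 / r x * r x)"
    using True by (simp add: bump_def powr_powr)
  also have "\<dots> = measure M A powr - 1" using assms by simp
  finally show ?thesis using True assms by (simp add: powr_minus_divide)
qed (simp add: bump_def)

text \<open>
  A factor \<open>1/\<eta> \<ge> 1\<close> raises the power by \<open>\<eta>\<^sup>-\<^sup>r\<close>, which is at least \<open>1/\<eta>\<close> because \<open>r \<ge> 1\<close>. The lower bound
  no longer depends on \<open>r\<close>.
\<close>

lemma bump_divide_powr_ge:
  assumes "1 \<le> r x" "0 < measure M A" "x \<in> A" "0 < \<eta>" "\<eta> \<le> 1"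
  shows "1 / (\<eta> * measure M A) \<le> \<bar>bump M r A x / \<eta>\<bar> powr r x"
proof -
  have "\<eta> powr r x \<le> \<eta>" using powr_mono'[of 1 "r x" \<eta>] assms by simp
  then have "1 / (\<eta> * measure M A) \<le> 1 / (\<eta> powr r x * measure M A)"
    using assms by (intro divide_left_mono) auto
  also have "\<dots> = \<bar>bump M r A x\<bar> powr r x / \<eta> powr r x"
    using assms by (simp add: bump_powr)
  also have "\<dots> = \<bar>bump M r A x / \<eta>\<bar> powr r x"
    using assms by (simp add: abs_divide powr_divide)
  finally show ?thesis .
qed

lemma modular_bump:
  assumes r: "\<And>x. 1 \<le> r x" and A: "A \<in> sets M" "0 < measure M A"
  shows "modular M r (bump M r A) = 1"
proof -
  have "\<bar>bump M r A x\<bar> powr r x = indicator A x / measure M A" for x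
    using r A(2) by (rule bump_powr)
  then have "modular M r (bump M r A) = (\<integral>\<^sup>+ x. ennreal (1 / measure M A) * indicator A x \<partial>M)"
    unfolding modular_def by (intro nn_integral_cong) (auto split: split_indicator)
  also have "\<dots> = ennreal (1 / measure M A) * ennreal (measure M A)"
    using A by (simp add: nn_integral_cmult_indicator emeasure_eq_ennreal_of_measure_pos)
  also have "\<dots> = 1" using A by (simp add: ennreal_mult[symmetric])
  finally show ?thesis .
qed

lemma bump_measurable:
  assumes "r \<in> borel_measurable N" "A \<in> sets N"
  shows "bump M r A \<in> borel_measurable N"
  using assms unfolding bump_def[abs_def] by measurable

lemma Lvar_fun_cong_AE:
  assumes f: "f \<in> Lvar_fun M r" and g: "g \<in> borel_measurable M" and eq: "AE x in M. f x = g x"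
  shows "g \<in> Lvar_fun M r"
proof -
  have "modular M r (\<lambda>x. f x / \<eta>) = modular M r (\<lambda>x. g x / \<eta>)" for \<eta>
    using eq by (intro modular_cong_AE) auto
  then show ?thesis using f g by (simp add: Lvar_fun_def)
qed

text \<open>
  On \<open>\<phi>\<^sup>-\<^sup>1(A)\<close> only the first bump is nonzero. If the norm were below \<open>c\<close>, the modular of the difference
  divided by some \<open>\<eta> < c\<close> would be at most \<open>1\<close>; but already its part over \<open>\<phi>\<^sup>-\<^sup>1(A)\<close> is at least
  \<open>\<mu>(\<phi>\<^sup>-\<^sup>1(A)) / (\<eta> \<mu>(A)) \<ge> c/\<eta> > 1\<close>.
\<close>

lemma Lvar_norm_bump_diff_ge:
  assumes \<phi>: "\<phi> \<in> measurable M borel" and r: "r \<in> borel_measurable borel" "\<And>x. 1 \<le> r x"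
    and A: "A \<in> sets borel" "A \<inter> B = {}" "0 < measure M A"
    and c: "0 < c" "c \<le> 1" "ennreal c * emeasure M A \<le> emeasure M (\<phi> -` A)"
    and sp: "space M = UNIV"
    and L: "bump M r A \<circ> \<phi> \<in> Lvar_fun M (r \<circ> \<phi>)" "bump M r B \<circ> \<phi> \<in> Lvar_fun M (r \<circ> \<phi>)"
  shows "c \<le> Lvar_norm M (r \<circ> \<phi>) (\<lambda>x. (bump M r A \<circ> \<phi>) x - (bump M r B \<circ> \<phi>) x)"
proof (rule ccontr)
  have r\<phi>: "r \<circ> \<phi> \<in> borel_measurable M" "\<And>x. 1 \<le> (r \<circ> \<phi>) x"
    using \<phi> r by auto
  let ?u = "\<lambda>x. (bump M r A \<circ> \<phi>) x - (bump M r B \<circ> \<phi>) x"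
  assume "\<not> ?thesis"
  then have less: "Lvar_norm M (r \<circ> \<phi>) ?u < c" by simp
  obtain \<eta> where \<eta>: "0 < \<eta>" "\<eta> < c" "modular M (r \<circ> \<phi>) (\<lambda>x. ?u x / \<eta>) \<le> 1"
    by (rule Lvar_norm_less[OF r\<phi> Lvar_diff[OF r\<phi> L] less])
  have pre: "\<phi> -` A \<in> sets M" using measurable_sets[OF \<phi> A(1)] sp by simp
  have "ennreal (c / \<eta>) = ennreal (1 / (\<eta> * measure M A)) * (ennreal c * ennreal (measure M A))"
    using A \<eta> c by (simp add: ennreal_mult[symmetric])
  also have "ennreal (measure M A) = emeasure M A"
    using emeasure_eq_ennreal_of_measure_pos[OF A(3)] by simp
  also have "ennreal (1 / (\<eta> * measure M A)) * (ennreal c * emeasure M A)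
      \<le> ennreal (1 / (\<eta> * measure M A)) * emeasure M (\<phi> -` A)"
    using c by (intro mult_left_mono) auto
  also have "\<dots> = (\<integral>\<^sup>+ x. ennreal (1 / (\<eta> * measure M A)) * indicator (\<phi> -` A) x \<partial>M)"
    using pre by (simp add: nn_integral_cmult_indicator)
  also have "\<dots> \<le> modular M (r \<circ> \<phi>) (\<lambda>x. ?u x / \<eta>)"
    unfolding modular_def
  proof (intro nn_integral_mono)
    fix x
    show "ennreal (1 / (\<eta> * measure M A)) * indicator (\<phi> -` A) x
        \<le> ennreal (\<bar>?u x / \<eta>\<bar> powr (r \<circ> \<phi>) x)"
    proof (cases "\<phi> x \<in> A")
      case True
      then have "\<phi> x \<notin> B" using A(2) by auto
      then have "?u x = bump M r A (\<phi> x)" by (simp add: bump_def)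
      then show ?thesis
        using bump_divide_powr_ge[of r "\<phi> x" M A \<eta>] True A r \<eta> c by (auto intro: ennreal_leI)
    qed simp
  qed
  also have "\<dots> \<le> 1" by (rule \<eta>(3))
  finally show False using \<eta> c by (simp add: ennreal_le_1 field_simps)
qed

section \<open>Composition operators\<close>

theorem theorem5:
  fixes M :: "'a::metric_space measure"
    and r :: "'a \<Rightarrow> real"
    and \<phi> :: "'a \<Rightarrow> 'a"
  assumes "metric_measure_space M"
    and "doubling M"
    and "r \<in> exponents"
    and "1 \<le> exp_inf M r" and "exp_inf M r \<le> exp_sup M r" and "exp_sup M r < \<infinity>"
    and "\<phi> \<in> borel_measurable borel"
    and "nonsingular M \<phi>"
    and "connected (UNIV :: 'a set)"
    and "\<exists>x y :: 'a. x \<noteq> y"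
  shows "\<not> compact_map (Lvar M r) (Lvar_dist M r) (Lvar M (r \<circ> \<phi>)) (Lvar_dist M (r \<circ> \<phi>))
           (comp_op M r \<phi>)"
proof
  assume T: "compact_map (Lvar M r) (Lvar_dist M r) (Lvar M (r \<circ> \<phi>)) (Lvar_dist M (r \<circ> \<phi>))
           (comp_op M r \<phi>)"
  note M = assms(1) and \<phi> = assms(7,8)
  have sp: "space M = UNIV" and bor: "\<And>A. A \<in> sets borel \<Longrightarrow> A \<in> sets M"
    using metric_measure_spaceD[OF M] by auto
  have phi: "\<phi> \<in> measurable M borel"
    using \<phi>(1) bor sp by (auto simp: measurable_def)
  have to_M: "f \<in> borel_measurable M" if "f \<in> borel_measurable borel" for f :: "'a \<Rightarrow> real"
    using that bor sp by (auto simp: measurable_def)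
  have rb: "r \<in> borel_measurable borel" and r1: "\<And>x. 1 \<le> r x"
    using assms(3) by (auto simp: exponents_def)
  note r = to_M[OF rb] r1
  have r\<phi>: "r \<circ> \<phi> \<in> borel_measurable M" "\<And>x. 1 \<le> (r \<circ> \<phi>) x"
    using phi rb r1 by auto
  interpret V: Metric_space "Lvar M r" "Lvar_dist M r"
    by (rule Metric_space_Lvar[OF r])
  interpret W: Metric_space "Lvar M (r \<circ> \<phi>)" "Lvar_dist M (r \<circ> \<phi>)"
    by (rule Metric_space_Lvar[OF r\<phi>])
  have "x islimpt UNIV" for x :: 'a
    using connected_imp_perfect[OF assms(9)] assms(10) by (metis UNIV_I singletonD)
  then have pt: "emeasure M {x} = 0" for x
    by (rule emeasure_singleton_eq_0[OF M assms(2)])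
  obtain c E where c: "0 < c" "c \<le> 1" and E: "E \<in> sets borel" "emeasure M E \<noteq> 0"
    and ge: "\<And>A. A \<in> sets borel \<Longrightarrow> A \<subseteq> E \<Longrightarrow> ennreal c * emeasure M A \<le> emeasure M (\<phi> -` A)"
    using ex_preimage_measure_ge[OF M \<phi>] by metis
  obtain A :: "nat \<Rightarrow> 'a set" and K where K: "infinite K" and disj: "disjoint_family A"
    and A: "\<And>k. A k \<in> sets borel" "\<And>k. A k \<subseteq> E" "\<And>k. k \<in> K \<Longrightarrow> emeasure M (A k) \<noteq> 0"
      "\<And>k. emeasure M (A k) < \<infinity>"
    using ex_infinite_disjoint_subsets[OF M pt E] by metis
  have pos: "0 < measure M (A k)" if "k \<in> K" for k
    using A(3,4)[of k] that by (auto simp: measure_def enn2real_positive_iff less_top zero_less_iff_neq_zero)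
  define f where "f k = bump M r (A k)" for k
  define F where "F k = Lvar_rel M r `` {f k}" for k
  have fb: "f k \<in> borel_measurable borel" for k
    unfolding f_def using rb A(1) by (rule bump_measurable)
  have f1: "modular M r (f k) = 1" if "k \<in> K" for k
    unfolding f_def using r1 bor[OF A(1)] pos[OF that] by (rule modular_bump)
  have fL: "f k \<in> Lvar_fun M r" if "k \<in> K" for k
    unfolding Lvar_fun_iff[OF r] using f1[OF that] to_M[OF fb] by (auto intro!: exI[of _ 1])
  have F: "F k \<in> Lvar M r" "f k \<in> F k" if "k \<in> K" for k
    unfolding F_def Lvar_def using fL[OF that] by (rule quotientI) (simp add: Lvar_rel_def fL[OF that])
  have TF: "f k \<circ> \<phi> \<in> Lvar_fun M (r \<circ> \<phi>)" "comp_op M r \<phi> (F k) \<in> Lvar M (r \<circ> \<phi>)"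
      "f k \<circ> \<phi> \<in> comp_op M r \<phi> (F k)" if k: "k \<in> K" for k
  proof -
    show W: "comp_op M r \<phi> (F k) \<in> Lvar M (r \<circ> \<phi>)"
      using T F(1)[OF k] by (auto simp: compact_map_def)
    \<comment> \<open>A nonempty image class only shows that \<open>g \<circ> \<phi>\<close> lies in the target space for some
        representative \<open>g\<close>; non-singularity carries this over to \<open>f k\<close>.\<close>
    then obtain h where h: "h \<in> comp_op M r \<phi> (F k)"
      using Lvar_some(1)[OF r\<phi>] by blast
    then obtain g where g: "(f k, g) \<in> Lvar_rel M r" "(g \<circ> \<phi>, h) \<in> Lvar_rel M (r \<circ> \<phi>)"
      by (auto simp: comp_op_def F_def)
    have "AE x in M. f k (\<phi> x) = g (\<phi> x)"
      using g(1) by (intro AE_comp_nonsingular[OF M \<phi>]) (simp add: Lvar_rel_def)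
    then have eq: "AE x in M. (g \<circ> \<phi>) x = (f k \<circ> \<phi>) x" by eventually_elim simp
    have "f k \<circ> \<phi> \<in> borel_measurable M" using phi fb by (rule measurable_comp)
    moreover have "g \<circ> \<phi> \<in> Lvar_fun M (r \<circ> \<phi>)"
      using g(2) unfolding Lvar_rel_def by blast
    ultimately show L: "f k \<circ> \<phi> \<in> Lvar_fun M (r \<circ> \<phi>)"
      using eq by (metis Lvar_fun_cong_AE)
    show "f k \<circ> \<phi> \<in> comp_op M r \<phi> (F k)"
      unfolding F_def comp_op_class[OF M \<phi> fL[OF k] L] using L by (simp add: Lvar_rel_def)
  qed
  have sep: "c \<le> Lvar_dist M (r \<circ> \<phi>) (comp_op M r \<phi> (F k)) (comp_op M r \<phi> (F l))"
    if kl: "k \<in> K" "l \<in> K" "k \<noteq> l" for k l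
  proof -
    have "A k \<inter> A l = {}" using disj kl by (auto simp: disjoint_family_on_def)
    then show ?thesis
      unfolding Lvar_dist_class[OF r\<phi> TF(2,3)[OF kl(1)] TF(2,3)[OF kl(2)]]
      using Lvar_norm_bump_diff_ge[OF phi rb r1 A(1) _ pos[OF kl(1)] c ge[OF A(1,2)] sp]
        TF(1)[OF kl(1)] TF(1)[OF kl(2)] unfolding f_def by blast
  qed
  have inj: "inj_on F K"
  proof (rule inj_onI, rule ccontr)
    fix k l assume "k \<in> K" "l \<in> K" "F k = F l" "k \<noteq> l"
    then show False using sep[of k l] W.zero[OF TF(2) TF(2), of l l] c by auto
  qed
  have "V.mbounded (F ` K)"
  proof -
    have 0: "(\<lambda>x. 0) \<in> Lvar_fun M r" by (auto simp: Lvar_fun_def modular_def intro: gt_ex)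
    define Z where "Z = Lvar_rel M r `` {\<lambda>x. 0}"
    have Z: "Z \<in> Lvar M r" "(\<lambda>x. 0) \<in> Z"
      unfolding Z_def Lvar_def using 0 by (rule quotientI) (simp add: Lvar_rel_def 0)
    have "\<forall>X\<in>F ` K. Lvar_dist M r Z X \<le> 1"
    proof clarify
      fix k assume k: "k \<in> K"
      have "modular M r (\<lambda>x. (0 - f k x) / 1) = 1"
        using f1[OF k] by (simp add: modular_def)
      then show "Lvar_dist M r Z (F k) \<le> 1"
        unfolding Lvar_dist_class[OF r Z F[OF k]] by (intro Lvar_norm_le[OF r]) auto
    qed
    moreover have "\<forall>X\<in>F ` K. X \<in> Lvar M r" using F(1) by blast
    ultimately show ?thesis
      unfolding V.mbounded using Z(1) by blast
  qed
  moreover have "infinite (F ` K)" using K inj finite_imageD by blast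
  moreover have "c \<le> Lvar_dist M (r \<circ> \<phi>) (comp_op M r \<phi> X) (comp_op M r \<phi> Y)"
    if "X \<in> F ` K" "Y \<in> F ` K" "X \<noteq> Y" for X Y
    using that sep by blast
  ultimately show False
    by (rule compact_map_not_separated[OF V.Metric_space_axioms W.Metric_space_axioms T _ _ c(1)])
qed

end
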